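(* Let $r\in\mathbb{Z}_{\ge 0}$ and let $\mathcal{F}\subseteq\mathcal{S}$ be a family of Catalan--Stanley trees with bivariate generating function $f(z,t)$. Then the family $(\rho^{-1})^{r}(\mathcal{F})=\{\tau\in\mathcal{S}:\rho^{r}(\tau)\in\mathcal{F}\}$ of trees obtained by expanding the trees of $\mathcal{F}$ $r$ times has generating function \[ \Phi^{r}(f(z,t)) = \frac{1}{1 - t\,\frac{1-T^{2r}}{1-T^{2}}}\, f\Big(z, \frac{t\,T^{2r}}{1 - t\,\frac{1-T^{2r}}{1-T^{2}}}\Big), \] where $T=T(z)=\frac{1-\sqrt{1-4z}}{2}$ and $\Phi(g(z,t))=\frac{1}{1-t}g\big(z,\frac{t}{1-t}T^2\big)$.
   Context: A rooted plane tree has ordered children at every node. For each child $c$ of the root, the rightmost leaf of the branch at $c$ is the leaf reached from $c$ by repeatedly moving to the rightmost child. A Catalan--Stanley tree is a rooted plane tree in which every such rightmost leaf has odd distance to the root (the one-node tree is included); $\mathcal{S}$ is the class of these trees. The reduction $\rho:\mathcal{S}\to\mathcal{S}$: for each rightmost leaf $\ell$ of a branch attached to the root, if $\ell$ is a child of the root it is deleted; otherwise all descendants of the grandparent of $\ell$ are deleted (the grandparent becomes a leaf). The one-node tree is mapped to itself. The bivariate generating function of $\mathcal{F}\subseteq\mathcal{S}$ is $\sum_{\tau\in\mathcal{F}} z^{a(\tau)}t^{b(\tau)}$, where $b(\tau)$ is the number of rightmost leaves of branches attached to the root and $a(\tau)$ the number of other nodes. $T(z)$ is the generating function of rooted plane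 trees by number of nodes, satisfying $T=z+T^2$. *)

theory Defs
  imports Complex_Main "HOL-Computational_Algebra.Formal_Power_Series"
begin

datatype plane_tree = Node (children: "plane_tree list")

text \<open>
  A node is represented by its address: the list of child indices (counted from 0, left to right)
  on the path from the root. The length of an address is the distance of the node to the root.
\<close>

fun is_node :: "nat list \<Rightarrow> plane_tree \<Rightarrow> bool" where
  "is_node [] \<tau> \<longleftrightarrow> True"
| "is_node (i # p) (Node ts) \<longleftrightarrow> i < length ts \<and> is_node p (ts ! i)"

definition nodes :: "plane_tree \<Rightarrow> nat list set" where
  "nodes \<tau> = {p. is_node p \<tau>}"

lemma size_last_less [termination_simp]:
  "ts \<noteq> [] \<Longrightarrow> size (last ts) < Suc (size_list size ts)"
  by (induction ts) auto

fun rightmost_leaf :: "plane_tree \<Rightarrow> nat list" where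
  "rightmost_leaf (Node ts) =
     (if ts = [] then [] else (length ts - 1) # rightmost_leaf (last ts))"

definition root_branch_leaves :: "plane_tree \<Rightarrow> nat list set" where
  "root_branch_leaves \<tau> =
     {i # rightmost_leaf (children \<tau> ! i) | i. i < length (children \<tau>)}"

definition catalan_stanley :: "plane_tree set" where
  "catalan_stanley = {\<tau>. \<forall>l \<in> root_branch_leaves \<tau>. odd (length l)}"

text \<open>Delete all proper descendants of the node with the given address.\<close>

fun prune_at :: "nat list \<Rightarrow> plane_tree \<Rightarrow> plane_tree" where
  "prune_at [] \<tau> = Node []"
| "prune_at (i # p) (Node ts) = Node (ts[i := prune_at p (ts ! i)])"

text \<open>
  Applying \<^const>\<open>butlast\<close> twice to the address of a leaf gives its grandparent. In a tree of
  \<^const>\<open>catalan_stanley\<close>, a branch that is not a single leaf has its rightmost leaf at depth at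
  least 2 inside the branch, so the grandparent lies in the branch. Outside of
  \<^const>\<open>catalan_stanley\<close> the value of \<open>reduction\<close> is irrelevant.
\<close>

definition reduction :: "plane_tree \<Rightarrow> plane_tree" where
  "reduction \<tau> =
     Node (map (\<lambda>c. prune_at (butlast (butlast (rightmost_leaf c))) c)
               (filter (\<lambda>c. c \<noteq> Node []) (children \<tau>)))"

text \<open>
  Formal power series in \<open>z\<close> and \<open>t\<close> are series in \<open>t\<close> whose coefficients are series in \<open>z\<close>, so
  that \<open>t\<close> is \<^const>\<open>fps_X\<close> in \<open>real fps fps\<close>, series in \<open>z\<close> alone are embedded by
  \<^const>\<open>fps_const\<close>, and substituting \<open>u\<close> for \<open>t\<close> in \<open>g\<close> is \<open>g oo u\<close>. The cardinalities below are
  those of finite sets, see \<open>finite_trees_with_nodes\<close> and \<open>finite_trees_with_stats\<close>.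
\<close>

definition bivariate_gf :: "plane_tree set \<Rightarrow> real fps fps" where
  "bivariate_gf F = Abs_fps (\<lambda>b. Abs_fps (\<lambda>a. of_nat (card
     {\<tau> \<in> F. card (nodes \<tau> - root_branch_leaves \<tau>) = a \<and> card (root_branch_leaves \<tau>) = b})))"

definition plane_tree_gf :: "real fps" where
  "plane_tree_gf = Abs_fps (\<lambda>n. of_nat (card {\<tau>. card (nodes \<tau>) = n}))"

definition Phi :: "real fps fps \<Rightarrow> real fps fps" where
  "Phi g = 1 / (1 - fps_X) * (g oo (fps_X / (1 - fps_X) * fps_const (plane_tree_gf ^ 2)))"

lemma nodes_Node:
  "nodes (Node ts) = insert [] (\<Union>i<length ts. (#) i ` nodes (ts ! i))"
proof -
  have "is_node p (Node ts) \<longleftrightarrow> p = [] \<or> (\<exists>i q. p = i # q \<and> i < length ts \<and> is_node q (ts ! i))" for p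
    by (cases p) auto
  then show ?thesis by (auto simp: nodes_def)
qed

lemma finite_nodes: "finite (nodes \<tau>)"
  by (induction \<tau>) (auto simp: nodes_Node)

lemma card_nodes_Node: "card (nodes (Node ts)) = Suc (\<Sum>i<length ts. card (nodes (ts ! i)))"
proof -
  have "card (\<Union>i<length ts. (#) i ` nodes (ts ! i)) = (\<Sum>i<length ts. card ((#) i ` nodes (ts ! i)))"
    by (rule card_UN_disjoint) (auto simp: finite_nodes)
  also have "\<dots> = (\<Sum>i<length ts. card (nodes (ts ! i)))"
    by (intro sum.cong refl card_image) (auto simp: inj_on_def)
  finally show ?thesis
    by (subst nodes_Node, subst card_insert_disjoint) (auto simp: finite_nodes)
qed

lemma card_nodes_pos: "0 < card (nodes \<tau>)"
  by (cases \<tau>) (simp add: card_nodes_Node)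

lemma finite_trees_le: "finite {\<tau>. card (nodes \<tau>) \<le> n}"
proof (induction n)
  case 0
  have "{\<tau>. card (nodes \<tau>) \<le> 0} = {}"
    using card_nodes_pos by (simp add: not_le)
  then show ?case by (metis finite.emptyI)
next
  case (Suc n)
  let ?L = "{ts. set ts \<subseteq> {\<tau>. card (nodes \<tau>) \<le> n} \<and> length ts \<le> n}"
  have "{\<tau>. card (nodes \<tau>) \<le> Suc n} \<subseteq> Node ` ?L"
  proof
    fix \<tau> assume "\<tau> \<in> {\<tau>. card (nodes \<tau>) \<le> Suc n}"
    moreover obtain ts where ts: "\<tau> = Node ts" by (cases \<tau>)
    ultimately have le: "(\<Sum>i<length ts. card (nodes (ts ! i))) \<le> n"
      by (simp add: card_nodes_Node)
    have "length ts = (\<Sum>i<length ts. 1)" by simp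
    also have "\<dots> \<le> (\<Sum>i<length ts. card (nodes (ts ! i)))"
      by (rule sum_mono) (metis One_nat_def Suc_leI card_nodes_pos)
    finally have len: "length ts \<le> n" using le by simp
    have "card (nodes (ts ! i)) \<le> n" if "i < length ts" for i
      using member_le_sum[of i "{..<length ts}" "\<lambda>i. card (nodes (ts ! i))"] that le by simp
    then have "set ts \<subseteq> {\<tau>. card (nodes \<tau>) \<le> n}"
      by (auto simp: in_set_conv_nth)
    with len ts show "\<tau> \<in> Node ` ?L" by blast
  qed
  moreover have "finite ?L" by (rule finite_lists_length_le[OF Suc])
  ultimately show ?case by (meson finite_imageI finite_subset)
qed

lemma finite_trees_with_nodes: "finite {\<tau>. card (nodes \<tau>) = n}"
  by (rule finite_subset[OF _ finite_trees_le[of n]]) auto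

lemma is_node_rightmost_leaf: "is_node (rightmost_leaf \<tau>) \<tau>"
  by (induction \<tau> rule: rightmost_leaf.induct) (auto simp: last_conv_nth)

lemma root_branch_leaves_subset: "root_branch_leaves \<tau> \<subseteq> nodes \<tau>"
  by (cases \<tau>) (auto simp: root_branch_leaves_def nodes_def is_node_rightmost_leaf)

lemma finite_trees_with_stats:
  "finite {\<tau> \<in> F. card (nodes \<tau> - root_branch_leaves \<tau>) = a \<and> card (root_branch_leaves \<tau>) = b}"
proof (rule finite_subset[OF _ finite_trees_with_nodes[of "a + b"]], clarify)
  fix \<tau>
  have "finite (root_branch_leaves \<tau>)"
    using finite_subset[OF root_branch_leaves_subset finite_nodes] .
  then show "card (nodes \<tau>) =
      card (nodes \<tau> - root_branch_leaves \<tau>) + card (root_branch_leaves \<tau>)"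
    using card_mono[OF finite_nodes root_branch_leaves_subset, of \<tau>]
    by (simp add: card_Diff_subset root_branch_leaves_subset)
qed

lemma rightmost_leaf_prune_at:
  "rightmost_leaf (prune_at (take k (rightmost_leaf \<tau>)) \<tau>) = take k (rightmost_leaf \<tau>)"
proof (induction \<tau> arbitrary: k rule: rightmost_leaf.induct)
  case (1 ts)
  show ?case
  proof (cases "ts = [] \<or> k = 0")
    case True
    then show ?thesis by auto
  next
    case False
    then obtain j where "k = Suc j" by (cases k) auto
    with False 1[of j] show ?thesis
      by (simp add: last_list_update last_conv_nth)
  qed
qed

lemma catalan_stanley_Node:
  "Node ts \<in> catalan_stanley \<longleftrightarrow> (\<forall>c \<in> set ts. even (length (rightmost_leaf c)))"
  by (force simp: catalan_stanley_def root_branch_leaves_def all_set_conv_all_nth)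

lemma reduction_catalan_stanley:
  assumes "\<tau> \<in> catalan_stanley"
  shows "reduction \<tau> \<in> catalan_stanley"
proof -
  have *: "butlast (butlast xs) = take (length xs - 2) xs" for xs :: "nat list"
    by (simp add: butlast_conv_take take_take min_def numeral_2_eq_2)
  obtain ts where "\<tau> = Node ts" by (cases \<tau>)
  with assms show ?thesis
    unfolding reduction_def catalan_stanley_Node *
    by (auto simp: catalan_stanley_Node rightmost_leaf_prune_at min_def)
qed

lemma reduction_Node_Nil: "reduction (Node []) = Node []"
  by (simp add: reduction_def)

end

theory Submission
  imports Defs
begin

text \<open>
  Cutting a branch along the path to its rightmost leaf writes it as a word of plane trees: each
  node on the path contributes the tree formed by itself and its subtrees off the path. The letters
  together contain all nodes of the branch except its rightmost leaf. A Catalan--Stanley tree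
  becomes a list of words of even length, and the reduction drops the empty words and removes the
  last two letters of all others. A preimage with \<open>n\<close> branches of a tree with \<open>k\<close> branches is
  therefore a choice of \<open>k\<close> of \<open>n\<close> positions and of two new letters for each of the \<open>k\<close> words, so
  the coefficient of \<open>t\<^sup>n\<close> is the sum of \<open>(n choose k) f\<^sub>k T\<^bsup>2k\<^esup>\<close> over \<open>k\<close>, and that is
  the coefficient of \<open>t\<^sup>n\<close> in \<^term>\<open>Phi f\<close>. Iterating \<^const>\<open>Phi\<close> composes Moebius
  transformations in \<open>t\<close>.
\<close>

unbundle fps_syntax

section \<open>Power series\<close>

text \<open>Coefficients lie in \<open>real fps\<close>, which is not a field; \<open>d\<close> is
  invertible because its constant coefficient 1 is its own inverse.\<close>

lemma fps_inverse_of_const_coeff_1: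
  fixes d :: "real fps fps"
  assumes "d $ 0 = 1"
  shows "x / d = x * inverse d" and "inverse d * d = 1"
proof -
  show "x / d = x * inverse d"
    using assms by (intro fps_divide_unit) auto
  have "inverse (1::real fps) = 1" by (simp add: fps_inverse_one')
  then show "inverse d * d = 1"
    unfolding fps_inverse_def using assms by (intro fps_left_inverse') auto
qed

text \<open>As \<open>u ^ k\<close> has no terms below degree \<open>k\<close>, the composition sum
  may run to \<open>n\<close> for every coefficient up to \<open>n\<close>, and this uniform bound
  allows the two sums to be swapped.\<close>

lemma fps_mult_compose_nth:
  fixes q g u :: "'a::idom fps"
  assumes "u $ 0 = 0"
  shows "(q * (g oo u)) $ n = (\<Sum>k\<le>n. g $ k * (q * u ^ k) $ n)"
proof -
  have "(g oo u) $ i = (\<Sum>k\<le>n. g $ k * u ^ k $ i)" if "i \<le> n" for i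
    unfolding fps_compose_nth
    using that startsby_zero_power_prefix[OF assms]
    by (intro sum.mono_neutral_left) auto
  then have "(q * (g oo u)) $ n = (\<Sum>i=0..n. \<Sum>k\<le>n. q $ (n - i) * (g $ k * u ^ k $ i))"
    by (subst mult.commute, subst fps_mult_nth) (simp add: sum_distrib_left sum_distrib_right mult_ac)
  also have "\<dots> = (\<Sum>k\<le>n. \<Sum>i=0..n. q $ (n - i) * (g $ k * u ^ k $ i))"
    by (rule sum.swap)
  also have "\<dots> = (\<Sum>k\<le>n. g $ k * (u ^ k * q) $ n)"
    by (intro sum.cong refl, subst fps_mult_nth) (simp add: sum_distrib_left mult_ac)
  finally show ?thesis by (simp add: mult.commute)
qed

text \<open>\<open>E k\<close> is the series of column \<open>k\<close> of Pascal's triangle, and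
  Pascal's rule reads \<open>E (Suc k) * (1 - fps_X) = E k * fps_X\<close>.\<close>

lemma inverse_one_minus_fps_X_power_nth:
  "(inverse (1 - fps_X) * (fps_X * inverse (1 - fps_X)) ^ k) $ n = (of_nat (n choose k) :: real fps)"
proof -
  define E :: "nat \<Rightarrow> real fps fps" where "E k = Abs_fps (\<lambda>n. of_nat (n choose k))" for k
  define Q :: "real fps fps" where "Q = inverse (1 - fps_X)"
  have Q: "Q * (1 - fps_X) = 1"
    unfolding Q_def by (rule fps_inverse_of_const_coeff_1) simp
  have E0: "E 0 * (1 - fps_X) = 1"
    by (rule fps_ext) (auto simp: E_def right_diff_distrib)
  have ES: "E (Suc k) * (1 - fps_X) = E k * fps_X" for k
  proof (rule fps_ext)
    fix n show "(E (Suc k) * (1 - fps_X)) $ n = (E k * fps_X) $ n"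
      by (cases n) (auto simp: E_def right_diff_distrib)
  qed
  have "E k = Q * (fps_X * Q) ^ k"
  proof (induction k)
    case 0
    have "E 0 = E 0 * (Q * (1 - fps_X))" by (simp add: Q)
    also have "\<dots> = (E 0 * (1 - fps_X)) * Q" by (simp add: mult_ac)
    finally show ?case by (simp add: E0)
  next
    case (Suc k)
    have "E (Suc k) = E (Suc k) * (Q * (1 - fps_X))" by (simp add: Q)
    also have "\<dots> = (E (Suc k) * (1 - fps_X)) * Q" by (simp add: mult_ac)
    finally show ?case by (simp add: ES Suc mult_ac)
  qed
  then show ?thesis by (simp add: Q_def E_def fps_eq_iff)
qed

lemma Phi_nth:
  "Phi g $ n = (\<Sum>k\<le>n. of_nat (n choose k) * g $ k * plane_tree_gf ^ (2 * k))"
proof -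
  let ?Q = "inverse (1 - fps_X) :: real fps fps"
  let ?c = "fps_const (plane_tree_gf ^ 2) :: real fps fps"
  have "Phi g = ?Q * (g oo (fps_X * ?Q * ?c))"
    by (simp add: Phi_def fps_inverse_of_const_coeff_1)
  also have "\<dots> $ n = (\<Sum>k\<le>n. g $ k * (?Q * (fps_X * ?Q * ?c) ^ k) $ n)"
    by (rule fps_mult_compose_nth) simp
  also have "\<dots> = (\<Sum>k\<le>n. g $ k * (fps_const (plane_tree_gf ^ (2 * k)) * (?Q * (fps_X * ?Q) ^ k)) $ n)"
    by (simp add: power_mult_distrib fps_const_power mult_ac flip: power_mult)
  finally show ?thesis
    by (simp only: fps_mult_left_const_nth inverse_one_minus_fps_X_power_nth) (simp add: mult_ac)
qed

section \<open>Closed form of the iterates of \<open>Phi\<close>\<close>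

text \<open>The quotient of the theorem appears as a finite geometric sum, so that the induction on
  \<open>r\<close> involves no division by \<open>1 - T^2\<close>.\<close>

definition closed_form :: "real fps fps \<Rightarrow> nat \<Rightarrow> real fps fps" where
  "closed_form g r =
     (let d = 1 - fps_X * fps_const (\<Sum>i<r. plane_tree_gf ^ (2 * i))
      in inverse d * (g oo (fps_X * fps_const (plane_tree_gf ^ (2 * r)) * inverse d)))"

text \<open>With \<open>u\<close> the series that \<open>Phi\<close> substitutes,
  \<open>d r oo u = d (Suc r) / (1 - fps_X)\<close>; this turns both the factor and the substituted
  series \<open>v r\<close> into those for \<open>Suc r\<close>.\<close>

lemma Phi_closed_form: "Phi (closed_form g r) = closed_form g (Suc r)"
proof -
  define T where "T = plane_tree_gf"
  define d :: "nat \<Rightarrow> real fps fps" where "d r = 1 - fps_X * fps_const (\<Sum>i<r. T ^ (2 * i))" for r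
  define Q :: "real fps fps" where "Q = inverse (1 - fps_X)"
  define u where "u = fps_X * Q * fps_const (T ^ 2)"
  define v where "v r = fps_X * fps_const (T ^ (2 * r)) * inverse (d r)" for r
  have Q: "Q * (1 - fps_X) = 1"
    unfolding Q_def by (rule fps_inverse_of_const_coeff_1) simp
  have d: "inverse (d r) * d r = 1" for r
    by (rule fps_inverse_of_const_coeff_1) (simp add: d_def)
  have u0: "u $ 0 = 0" and v0: "v r $ 0 = 0" for r by (simp_all add: u_def v_def)
  \<comment> \<open>The first summand is split off, since substituting \<open>u\<close> multiplies
    the old sum by \<open>T^2\<close>.\<close>
  have "(\<Sum>i<Suc r. T ^ (2 * i)) = 1 + T ^ 2 * (\<Sum>i<r. T ^ (2 * i))"
    by (subst sum.lessThan_Suc_shift) (simp add: sum_distrib_left power_add[symmetric])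
  then have dSuc: "d (Suc r) = 1 - fps_X - fps_X * fps_const (T ^ 2) * fps_const (\<Sum>i<r. T ^ (2 * i))"
    unfolding d_def
    by (simp only: fps_const_add[symmetric] fps_const_mult[symmetric] fps_const_1_eq_1) (simp add: algebra_simps)
  have "d r oo u = 1 - u * fps_const (\<Sum>i<r. T ^ (2 * i))"
    by (simp add: d_def fps_compose_sub_distrib fps_compose_mult_distrib u0)
  also have "\<dots> = Q * (1 - fps_X) - u * fps_const (\<Sum>i<r. T ^ (2 * i))"
    by (simp add: Q)
  also have "\<dots> = Q * d (Suc r)"
    unfolding dSuc u_def by (simp add: algebra_simps)
  finally have du: "d r oo u = Q * d (Suc r)" .
  have *: "Q * (inverse (d r) oo u) = inverse (d (Suc r))"
  proof -
    \<comment> \<open>Substituting \<open>u\<close> is a ring homomorphism, so it carries inverses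
      to inverses.\<close>
    have "(inverse (d r) oo u) * (d r oo u) = 1"
      by (simp add: fps_compose_mult_distrib[OF u0, symmetric] d)
    then have "Q * (inverse (d r) oo u) * d (Suc r) = inverse (d (Suc r)) * d (Suc r)"
      by (simp only: du d) (simp add: mult_ac)
    moreover have "d (Suc r) \<noteq> 0" using d[of "Suc r"] by auto
    ultimately show ?thesis by simp
  qed
  have "v r oo u = u * fps_const (T ^ (2 * r)) * (inverse (d r) oo u)"
    by (simp add: v_def fps_compose_mult_distrib u0)
  also have "\<dots> = fps_X * fps_const (T ^ 2) * fps_const (T ^ (2 * r)) * (Q * (inverse (d r) oo u))"
    by (simp add: u_def mult_ac)
  also have "\<dots> = v (Suc r)"
    unfolding * v_def by (simp add: mult.assoc power_add[symmetric])
  finally have vu: "v r oo u = v (Suc r)" .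
  have "Phi (closed_form g r) = Q * ((inverse (d r) * (g oo v r)) oo u)"
    by (simp add: Phi_def closed_form_def Let_def fps_inverse_of_const_coeff_1 Q_def u_def d_def v_def T_def)
  also have "\<dots> = Q * (inverse (d r) oo u) * (g oo v r oo u)"
    by (simp add: fps_compose_mult_distrib u0 mult_ac)
  also have "g oo v r oo u = g oo v (Suc r)"
    by (simp add: fps_compose_assoc[OF u0 v0, symmetric] vu)
  finally have "Phi (closed_form g r) = inverse (d (Suc r)) * (g oo v (Suc r))"
    unfolding * .
  then show ?thesis
    by (simp add: closed_form_def Let_def d_def v_def T_def)
qed

lemma Phi_power: "(Phi ^^ r) g = closed_form g r"
proof (induction r)
  case 0
  show ?case by (simp add: closed_form_def fps_inverse_one')
next
  case (Suc r)
  then show ?case by (simp add: Phi_closed_form)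
qed

section \<open>Counting by weight\<close>

text \<open>Finiteness is part of the notion because \<open>card\<close> is 0 on infinite sets,
  which would break the sum and product rules.\<close>

definition has_gf :: "('a \<Rightarrow> nat) \<Rightarrow> 'a set \<Rightarrow> real fps \<Rightarrow> bool" where
  "has_gf w A f \<longleftrightarrow> (\<forall>n. finite {x \<in> A. w x = n} \<and> f $ n = of_nat (card {x \<in> A. w x = n}))"

lemma has_gf_unique: "has_gf w A f \<Longrightarrow> has_gf w A g \<Longrightarrow> f = g"
  by (simp add: has_gf_def fps_eq_iff)

lemma has_gf_empty: "has_gf w {} 0"
  by (simp add: has_gf_def)

lemma has_gf_singleton: "has_gf w {x} (fps_X ^ w x)"
proof -
  have "{y \<in> {x}. w y = n} = (if n = w x then {x} else {})" for n by auto
  then show ?thesis by (simp add: has_gf_def fps_X_power_nth)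
qed

lemma has_gf_Un:
  assumes "has_gf w A f" "has_gf w B g" "A \<inter> B = {}"
  shows "has_gf w (A \<union> B) (f + g)"
proof -
  have "{x \<in> A \<union> B. w x = n} = {x \<in> A. w x = n} \<union> {x \<in> B. w x = n}" for n by auto
  moreover have "{x \<in> A. w x = n} \<inter> {x \<in> B. w x = n} = {}" for n using assms(3) by auto
  ultimately show ?thesis using assms(1,2) by (simp add: has_gf_def card_Un_disjoint)
qed

lemma has_gf_image:
  assumes "has_gf v A f" "inj_on h A" "\<And>x. x \<in> A \<Longrightarrow> w (h x) = v x"
  shows "has_gf w (h ` A) f"
proof -
  have "{y \<in> h ` A. w y = n} = h ` {x \<in> A. v x = n}" for n using assms(3) by force
  moreover have "inj_on h {x \<in> A. v x = n}" for n
    using assms(2) by (rule inj_on_subset) auto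
  ultimately show ?thesis using assms(1) by (simp add: has_gf_def card_image)
qed

lemma has_gf_Times:
  assumes "has_gf v A f" "has_gf w B g"
  shows "has_gf (\<lambda>(x, y). v x + w y) (A \<times> B) (f * g)"
  unfolding has_gf_def
proof (intro allI conjI)
  fix n
  let ?S = "{p \<in> A \<times> B. (case p of (x, y) \<Rightarrow> v x + w y) = n}"
  let ?P = "\<lambda>i. {x \<in> A. v x = i} \<times> {y \<in> B. w y = n - i}"
  have S: "?S = (\<Union>i\<in>{0..n}. ?P i)" by auto
  have fin: "finite (?P i)" for i using assms by (simp add: has_gf_def)
  show "finite ?S" unfolding S using fin by blast
  have "card ?S = (\<Sum>i=0..n. card (?P i))"
    unfolding S using fin by (intro card_UN_disjoint) auto
  then show "(f * g) $ n = of_nat (card ?S)"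
    using assms by (simp add: has_gf_def fps_mult_nth card_cartesian_product)
qed

lemma has_gf_shift:
  assumes "has_gf w A f"
  shows "has_gf (\<lambda>x. k + w x) A (fps_X ^ k * f)"
  unfolding has_gf_def
proof
  fix n
  have "{x \<in> A. k + w x = n} = (if n < k then {} else {x \<in> A. w x = n - k})" by auto
  then show "finite {x \<in> A. k + w x = n} \<and>
      (fps_X ^ k * f) $ n = of_nat (card {x \<in> A. k + w x = n})"
    using assms by (simp add: has_gf_def fps_X_power_mult_nth)
qed

section \<open>The generating function of plane trees\<close>

lemma has_gf_plane_tree: "has_gf (\<lambda>\<tau>. card (nodes \<tau>)) UNIV plane_tree_gf"
  by (simp add: has_gf_def plane_tree_gf_def finite_trees_with_nodes)

lemma card_nodes_sum_list:
  "card (nodes (Node ts)) = Suc (\<Sum>t\<leftarrow>ts. card (nodes t))"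
  by (simp add: card_nodes_Node sum_list_sum_nth atLeast0LessThan)

text \<open>A tree with more than one node splits uniquely into its leftmost subtree
  \<open>t\<close> and the remaining tree \<open>s\<close>, and their node counts add up.\<close>

lemma plane_tree_gf_equation: "plane_tree_gf = fps_X + plane_tree_gf ^ 2"
proof -
  let ?w = "\<lambda>\<tau>. card (nodes \<tau>)"
  let ?h = "\<lambda>(t, s). Node (t # children s)"
  have U: "(UNIV :: plane_tree set) = {Node []} \<union> ?h ` (UNIV \<times> UNIV)"
  proof -
    have "\<tau> \<in> {Node []} \<union> ?h ` (UNIV \<times> UNIV)" for \<tau>
    proof (cases \<tau>)
      case (Node ts)
      then show ?thesis
        by (cases ts) (auto intro!: image_eqI[of _ _ "(t, Node us)" for t us])
    qed
    then show ?thesis by blast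
  qed
  have "has_gf ?w (?h ` (UNIV \<times> UNIV)) (plane_tree_gf * plane_tree_gf)"
  proof (rule has_gf_image[OF has_gf_Times[OF has_gf_plane_tree has_gf_plane_tree]])
    show "inj_on ?h (UNIV \<times> UNIV)"
      by (auto simp: inj_on_def intro: plane_tree.expand)
    show "?w (?h p) = (case p of (x, y) \<Rightarrow> ?w x + ?w y)" for p
    proof (cases p)
      case (Pair t s)
      then show ?thesis by (cases s) (simp add: card_nodes_sum_list)
    qed
  qed
  moreover have "has_gf ?w {Node []} fps_X"
    using has_gf_singleton[of ?w "Node []"] by (simp add: card_nodes_sum_list)
  ultimately have "has_gf ?w UNIV (fps_X + plane_tree_gf * plane_tree_gf)"
    by (subst U, intro has_gf_Un) auto
  from has_gf_unique[OF has_gf_plane_tree this] show ?thesis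
    by (simp add: power2_eq_square)
qed

lemma plane_tree_gf_nth_0: "plane_tree_gf $ 0 = 0"
proof -
  have "card (nodes \<tau>) \<noteq> 0" for \<tau> using card_nodes_pos[of \<tau>] by simp
  then have "{\<tau>. card (nodes \<tau>) = 0} = {}" by blast
  then show ?thesis by (simp only: plane_tree_gf_def fps_nth_Abs_fps card.empty of_nat_0)
qed

text \<open>Completing the square gives \<open>(1 - 2T)^2 = 1 - 4z\<close>; the constant coefficient
  1 of \<open>1 - 2T\<close> selects the root.\<close>

lemma plane_tree_gf_radical: "plane_tree_gf = (1 - fps_radical root 2 (1 - 4 * fps_X)) / 2"
proof -
  let ?T = plane_tree_gf
  have "(1 - 2 * ?T) ^ 2 = 1 - 4 * (?T - ?T ^ 2)"
    by (simp add: power2_eq_square algebra_simps)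
  also have "?T - ?T ^ 2 = fps_X"
    by (metis plane_tree_gf_equation add_diff_cancel_right')
  finally have "(1 - 2 * ?T) ^ Suc 1 = 1 - 4 * fps_X" by (simp add: numeral_2_eq_2)
  moreover have "(1 - 2 * ?T) ^ Suc 1 = 1 - 4 * fps_X \<longleftrightarrow>
      1 - 2 * ?T = fps_radical root (Suc 1) (1 - 4 * fps_X)"
    by (rule radical_unique) (simp_all add: plane_tree_gf_nth_0)
  ultimately have "1 - 2 * ?T = fps_radical root 2 (1 - 4 * fps_X)"
    by (simp add: numeral_2_eq_2)
  then have "1 - fps_radical root 2 (1 - 4 * fps_X) = ?T * 2" by (simp add: algebra_simps)
  then show ?thesis by (simp only: nonzero_mult_div_cancel_right[OF zero_neq_numeral[symmetric]])
qed

section \<open>Spines\<close>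

text \<open>Together with \<open>unspine\<close> this is a bijection between plane trees and words
  of plane trees. The final leaf gives no letter, so word length is the depth of the rightmost
  leaf.\<close>

fun spine :: "plane_tree \<Rightarrow> plane_tree list" where
  "spine (Node ts) = (if ts = [] then [] else Node (butlast ts) # spine (last ts))"

fun unspine :: "plane_tree list \<Rightarrow> plane_tree" where
  "unspine [] = Node []"
| "unspine (t # s) = Node (children t @ [unspine s])"

lemma spine_unspine: "spine (unspine s) = s"
  by (induction s rule: unspine.induct) auto

lemma unspine_spine: "unspine (spine c) = c"
  by (induction c rule: spine.induct) auto

lemma spine_eq_Nil_iff: "spine c = [] \<longleftrightarrow> c = Node []"
  by (cases c) auto

lemma length_spine: "length (spine c) = length (rightmost_leaf c)"
  by (induction c rule: spine.induct) auto

lemma card_nodes_spine: "card (nodes c) = Suc (\<Sum>t\<leftarrow>spine c. card (nodes t))"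
proof (induction c rule: spine.induct)
  case (1 ts)
  show ?case
  proof (cases ts rule: rev_cases)
    case (snoc us u)
    then show ?thesis using 1 by (simp add: card_nodes_sum_list)
  qed (simp add: card_nodes_sum_list)
qed

text \<open>Pruning at a node of the rightmost path makes that node the new rightmost leaf, so just
  the letters above it survive.\<close>

lemma spine_prune_at:
  "spine (prune_at (take k (rightmost_leaf c)) c) = take k (spine c)"
proof (induction c arbitrary: k rule: spine.induct)
  case (1 ts)
  show ?case
  proof (cases ts rule: rev_cases)
    case (snoc us u)
    then show ?thesis using 1 by (cases k) simp_all
  qed simp
qed

definition spines :: "plane_tree \<Rightarrow> plane_tree list list" where
  "spines \<tau> = map spine (children \<tau>)"

definition of_spines :: "plane_tree list list \<Rightarrow> plane_tree" where
  "of_spines ds = Node (map unspine ds)"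

lemma spines_of_spines: "spines (of_spines ds) = ds"
  by (simp add: spines_def of_spines_def spine_unspine comp_def)

lemma of_spines_spines: "of_spines (spines \<tau>) = \<tau>"
  by (cases \<tau>) (simp add: spines_def of_spines_def unspine_spine comp_def)

text \<open>The edge from the root to the branch turns odd distance from the root into even depth
  inside the branch.\<close>

lemma catalan_stanley_spines:
  "\<tau> \<in> catalan_stanley \<longleftrightarrow> (\<forall>d \<in> set (spines \<tau>). even (length d))"
  by (cases \<tau>) (simp add: catalan_stanley_Node spines_def length_spine)

lemma butlast_butlast_conv_take: "butlast (butlast xs) = take (length xs - 2) xs"
  by (simp add: butlast_conv_take min_def numeral_2_eq_2)

text \<open>Applying \<open>butlast\<close> twice to the address of the leaf does the same to the
  word, because both become prefixes of equal length; the branches deleted as single leaves are the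
  empty words.\<close>

lemma spines_reduction:
  "spines (reduction \<tau>) = map (\<lambda>d. butlast (butlast d)) (filter (\<lambda>d. d \<noteq> []) (spines \<tau>))"
  by (simp add: spines_def reduction_def filter_map comp_def spine_eq_Nil_iff spine_prune_at
      length_spine butlast_butlast_conv_take)

lemma card_root_branch_leaves: "card (root_branch_leaves \<tau>) = length (spines \<tau>)"
proof -
  have "root_branch_leaves \<tau> = (\<lambda>i. i # rightmost_leaf (children \<tau> ! i)) ` {..<length (children \<tau>)}"
    by (auto simp: root_branch_leaves_def)
  moreover have "inj_on (\<lambda>i. i # rightmost_leaf (children \<tau> ! i)) {..<length (children \<tau>)}"
    by (auto simp: inj_on_def)
  ultimately show ?thesis by (simp add: card_image spines_def)
qed

abbreviation spines_weight :: "plane_tree list list \<Rightarrow> nat" where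
  "spines_weight ds \<equiv> (\<Sum>d\<leftarrow>ds. \<Sum>t\<leftarrow>d. card (nodes t))"

text \<open>\<open>Suc\<close> counts the root; the letters hold all nodes other than the root and
  the rightmost leaves.\<close>

lemma card_nodes_minus_leaves:
  "card (nodes \<tau> - root_branch_leaves \<tau>) = Suc (spines_weight (spines \<tau>))"
proof -
  have "card (nodes \<tau>) = Suc (length (spines \<tau>) + spines_weight (spines \<tau>))"
  proof (cases \<tau>)
    case (Node ts)
    have "(\<Sum>t\<leftarrow>ts. card (nodes t)) = length (map spine ts) + spines_weight (map spine ts)"
    proof (induction ts)
      case (Cons t ts)
      then show ?case using card_nodes_spine[of t] by simp
    qed simp
    then show ?thesis using Node by (simp add: card_nodes_sum_list spines_def)
  qed
  moreover have "finite (root_branch_leaves \<tau>)"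
    using finite_subset[OF root_branch_leaves_subset finite_nodes] .
  ultimately show ?thesis
    by (simp add: card_Diff_subset root_branch_leaves_subset card_root_branch_leaves)
qed

section \<open>The fibres of the reduction\<close>

text \<open>The number of branches is fixed since empty words carry no weight: arbitrarily many of
  them could be inserted at the same weight.\<close>

definition expansions :: "nat \<Rightarrow> plane_tree list list \<Rightarrow> plane_tree list list set" where
  "expansions n cs = {ds. length ds = n \<and> (\<forall>d \<in> set ds. even (length d)) \<and>
     map (\<lambda>d. butlast (butlast d)) (filter (\<lambda>d. d \<noteq> []) ds) = cs}"

lemma expansions_0: "expansions 0 cs = (if cs = [] then {[]} else {})"
  by (auto simp: expansions_def)

lemma expansions_Suc_Nil: "expansions (Suc n) [] = Cons [] ` expansions n []"
proof -
  have "ds \<in> Cons [] ` expansions n []" if "ds \<in> expansions (Suc n) []" for ds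
    using that by (cases ds) (auto simp: expansions_def filter_empty_conv)
  then show ?thesis by (auto simp: expansions_def)
qed

lemma even_length_butlast_butlast:
  assumes "even (length d)" "d \<noteq> []"
  obtains u v where "d = butlast (butlast d) @ [u, v]"
proof (cases d rule: rev_cases)
  case (snoc e v)
  then show ?thesis using assms that by (cases e rule: rev_cases) (auto simp: butlast_append)
qed (use assms in simp)

text \<open>The first word is empty and disappears, or it is \<open>c\<close> with two arbitrary
  letters appended; even length of \<open>c\<close> keeps the extended word even.\<close>

lemma expansions_Suc_Cons:
  assumes "even (length c)"
  shows "expansions (Suc n) (c # cs) = Cons [] ` expansions n (c # cs) \<union>
    (\<lambda>((u, v), ds). (c @ [u, v]) # ds) ` ((UNIV \<times> UNIV) \<times> expansions n cs)"
    (is "_ = ?A \<union> ?h ` ?B")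
proof -
  have "ds \<in> ?A \<union> ?h ` ?B" if ds: "ds \<in> expansions (Suc n) (c # cs)" for ds
  proof -
    obtain d es where d: "ds = d # es" using ds by (cases ds) (auto simp: expansions_def)
    show ?thesis
    proof (cases "d = []")
      case True
      then show ?thesis using ds d by (auto simp: expansions_def)
    next
      case False
      then obtain u v where uv: "d = butlast (butlast d) @ [u, v]"
        using ds d even_length_butlast_butlast[of d] by (auto simp: expansions_def)
      moreover have "butlast (butlast d) = c" "es \<in> expansions n cs"
        using ds d False by (auto simp: expansions_def)
      ultimately have "ds = ?h ((u, v), es)" "((u, v), es) \<in> ?B" using d by auto
      then show ?thesis by blast
    qed
  qed
  moreover have "?A \<union> ?h ` ?B \<subseteq> expansions (Suc n) (c # cs)"
    using assms by (auto simp: expansions_def butlast_append)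
  ultimately show ?thesis by blast
qed

text \<open>
  Splitting off the first branch of the expanded tree, which is either a new leaf or an expansion
  of \<open>c\<close>, gives Pascal's rule for the coefficients.
\<close>

lemma has_gf_expansions:
  assumes "\<forall>c \<in> set cs. even (length c)"
  shows "has_gf spines_weight (expansions n cs)
    (of_nat (n choose length cs) * plane_tree_gf ^ (2 * length cs) * fps_X ^ spines_weight cs)"
  using assms
proof (induction n arbitrary: cs)
  case 0
  show ?case
    using has_gf_singleton[of spines_weight "[]"] has_gf_empty[of spines_weight]
    by (cases cs) (auto simp: expansions_0)
next
  case (Suc n)
  \<comment> \<open>A new leaf in front adds no weight and leaves \<open>cs\<close> to the other
    \<open>n\<close> words; both cases below use this.\<close>
  have leaf: "has_gf spines_weight (Cons [] ` expansions n cs)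
    (of_nat (n choose length cs) * plane_tree_gf ^ (2 * length cs) * fps_X ^ spines_weight cs)"
    by (rule has_gf_image[OF Suc.IH[OF Suc.prems]]) auto
  show ?case
  proof (cases cs)
    case Nil
    then show ?thesis using leaf by (simp add: expansions_Suc_Nil)
  next
    case (Cons c cs')
    let ?w = "\<lambda>\<tau>. card (nodes \<tau>)"
    let ?g = "\<lambda>cs. of_nat (n choose length cs) * plane_tree_gf ^ (2 * length cs) * fps_X ^ spines_weight cs"
    let ?h = "\<lambda>((u, v), ds). (c @ [u, v]) # ds"
    let ?wc = "\<Sum>t\<leftarrow>c. ?w t"
    have "has_gf spines_weight (expansions n cs') (?g cs')"
      using Suc Cons by simp
    \<comment> \<open>Each of the two new letters is an arbitrary plane tree and gives a factor
      \<open>plane_tree_gf\<close>; the old letters of \<open>c\<close> give the fixed weight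
      \<open>?wc\<close>.\<close>
    then have "has_gf (\<lambda>(p, ds). (case p of (u, v) \<Rightarrow> ?w u + ?w v) + spines_weight ds)
        ((UNIV \<times> UNIV) \<times> expansions n cs') (plane_tree_gf * plane_tree_gf * ?g cs')"
      by (intro has_gf_Times has_gf_plane_tree) auto
    from has_gf_shift[OF this, of ?wc]
    have "has_gf spines_weight (?h ` ((UNIV \<times> UNIV) \<times> expansions n cs'))
        (fps_X ^ ?wc * (plane_tree_gf * plane_tree_gf * ?g cs'))"
      by (rule has_gf_image) (auto simp: inj_on_def)
    then have "has_gf spines_weight (expansions (Suc n) cs)
        (?g cs + fps_X ^ ?wc * (plane_tree_gf * plane_tree_gf * ?g cs'))"
      using leaf Suc.prems unfolding Cons
      by (subst expansions_Suc_Cons) (auto intro!: has_gf_Un)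
    also have "?g cs + fps_X ^ ?wc * (plane_tree_gf * plane_tree_gf * ?g cs') =
        of_nat (Suc n choose length cs) * plane_tree_gf ^ (2 * length cs) * fps_X ^ spines_weight cs"
      by (simp add: Cons power_add algebra_simps)
    finally show ?thesis .
  qed
qed

text \<open>\<open>of_spines\<close> carries the expansions of the word list of \<sigma> bijectively
  to the fibre, and the shift by 1 adds the root.\<close>

lemma has_gf_fibre:
  assumes "\<sigma> \<in> catalan_stanley"
  shows "has_gf (\<lambda>\<tau>. card (nodes \<tau> - root_branch_leaves \<tau>))
    {\<tau> \<in> catalan_stanley. reduction \<tau> = \<sigma> \<and> card (root_branch_leaves \<tau>) = n}
    (of_nat (n choose card (root_branch_leaves \<sigma>)) *
     plane_tree_gf ^ (2 * card (root_branch_leaves \<sigma>)) *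
     fps_X ^ card (nodes \<sigma> - root_branch_leaves \<sigma>))"
    (is "has_gf ?w ?S ?f")
proof -
  let ?k = "length (spines \<sigma>)"
  have inj: "spines \<tau> = spines \<tau>' \<longleftrightarrow> \<tau> = \<tau>'" for \<tau> \<tau>' by (metis of_spines_spines)
  have "has_gf (\<lambda>ds. 1 + spines_weight ds) (expansions n (spines \<sigma>))
      (fps_X ^ 1 * (of_nat (n choose ?k) * plane_tree_gf ^ (2 * ?k) * fps_X ^ spines_weight (spines \<sigma>)))"
    using assms by (intro has_gf_shift has_gf_expansions) (simp add: catalan_stanley_spines)
  then have "has_gf ?w (of_spines ` expansions n (spines \<sigma>))
      (fps_X ^ 1 * (of_nat (n choose ?k) * plane_tree_gf ^ (2 * ?k) * fps_X ^ spines_weight (spines \<sigma>)))"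
  proof (rule has_gf_image)
    show "inj_on of_spines (expansions n (spines \<sigma>))"
      by (rule inj_on_inverseI[of _ spines]) (rule spines_of_spines)
  qed (simp add: card_nodes_minus_leaves spines_of_spines)
  also have "of_spines ` expansions n (spines \<sigma>) = ?S"
  proof (intro equalityI subsetI)
    fix \<tau> assume "\<tau> \<in> of_spines ` expansions n (spines \<sigma>)"
    then show "\<tau> \<in> ?S"
      by (auto simp: expansions_def catalan_stanley_spines card_root_branch_leaves spines_of_spines
          spines_reduction simp flip: inj)
  next
    fix \<tau> assume "\<tau> \<in> ?S"
    then have "spines \<tau> \<in> expansions n (spines \<sigma>)"
      by (auto simp: expansions_def catalan_stanley_spines card_root_branch_leaves spines_reduction)
    then show "\<tau> \<in> of_spines ` expansions n (spines \<sigma>)"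
      by (rule image_eqI[rotated]) (simp add: of_spines_spines)
  qed
  finally show ?thesis
    by (simp add: card_root_branch_leaves card_nodes_minus_leaves mult_ac)
qed

section \<open>Preimages of families under iterated reduction\<close>

text \<open>The preimage is the disjoint union of the fibres. As \<open>F\<close> may be infinite,
  only trees with statistics in the box \<open>I\<close> are kept, and all fibres over one class
  \<open>G (k, i)\<close> have equal size \<open>c (k, i)\<close>.\<close>

lemma bivariate_gf_preimage:
  assumes "F \<subseteq> catalan_stanley"
  shows "bivariate_gf {\<tau> \<in> catalan_stanley. reduction \<tau> \<in> F} = Phi (bivariate_gf F)"
proof (intro fps_ext)
  fix n m
  let ?T = plane_tree_gf
  let ?a = "\<lambda>\<tau>. card (nodes \<tau> - root_branch_leaves \<tau>)"
  let ?b = "\<lambda>\<tau>. card (root_branch_leaves \<tau>)"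
  define Fib where "Fib \<sigma> = {\<tau> \<in> catalan_stanley. reduction \<tau> = \<sigma> \<and> ?b \<tau> = n \<and> ?a \<tau> = m}" for \<sigma>
  define G where "G = (\<lambda>(k, i). {\<sigma> \<in> F. ?a \<sigma> = i \<and> ?b \<sigma> = k})"
  define I where "I = {..n} \<times> {..m}"
  define c :: "nat \<times> nat \<Rightarrow> real" where
    "c = (\<lambda>(k, i). of_nat (n choose k) * (?T ^ (2 * k)) $ (m - i))"
  have finG: "finite (G p)" for p
    by (cases p) (simp add: G_def finite_trees_with_stats)
  have Fib: "finite (Fib \<sigma>)"
    "of_nat (card (Fib \<sigma>)) = of_nat (n choose ?b \<sigma>) * (?T ^ (2 * ?b \<sigma>) * fps_X ^ ?a \<sigma>) $ m"
    if "\<sigma> \<in> F" for \<sigma>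
  proof -
    have *: "Fib \<sigma> = {\<tau> \<in> {\<tau> \<in> catalan_stanley. reduction \<tau> = \<sigma> \<and> ?b \<tau> = n}. ?a \<tau> = m}"
      by (auto simp: Fib_def)
    have gf: "has_gf ?a {\<tau> \<in> catalan_stanley. reduction \<tau> = \<sigma> \<and> ?b \<tau> = n}
        (of_nat (n choose ?b \<sigma>) * ?T ^ (2 * ?b \<sigma>) * fps_X ^ ?a \<sigma>)"
      using that assms by (intro has_gf_fibre) auto
    show "finite (Fib \<sigma>)" using gf unfolding * has_gf_def by blast
    have "of_nat (card (Fib \<sigma>)) = (of_nat (n choose ?b \<sigma>) * ?T ^ (2 * ?b \<sigma>) * fps_X ^ ?a \<sigma>) $ m"
      using gf unfolding * has_gf_def by simp
    then show "of_nat (card (Fib \<sigma>)) = of_nat (n choose ?b \<sigma>) * (?T ^ (2 * ?b \<sigma>) * fps_X ^ ?a \<sigma>) $ m"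
      by (simp only: mult.assoc fps_of_nat[symmetric] fps_mult_left_const_nth)
  qed
  \<comment> \<open>The binomial coefficient vanishes for more than \<open>n\<close> branches, and
    the factor \<open>fps_X ^ ?a \<sigma>\<close> kills coefficient \<open>m\<close> if
    \<open>?a \<sigma> > m\<close>; so nonempty fibres lie over \<open>I\<close>.\<close>
  have I: "(?b \<sigma>, ?a \<sigma>) \<in> I" if "\<sigma> \<in> F" "\<tau> \<in> Fib \<sigma>" for \<sigma> \<tau>
  proof -
    have "card (Fib \<sigma>) \<noteq> 0" using that Fib(1) by auto
    then show ?thesis using Fib(2)[OF that(1)]
      by (auto simp: I_def fps_X_power_mult_right_nth binomial_eq_0 split: if_splits intro!: leI)
  qed
  have UG: "(\<Union>p\<in>I. G p) \<subseteq> F" "\<And>\<sigma>. \<sigma> \<in> F \<Longrightarrow> (?b \<sigma>, ?a \<sigma>) \<in> I \<Longrightarrow> \<sigma> \<in> (\<Union>p\<in>I. G p)"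
    by (auto simp: G_def)
  have "{\<tau> \<in> {\<tau> \<in> catalan_stanley. reduction \<tau> \<in> F}. ?a \<tau> = m \<and> ?b \<tau> = n} = (\<Union>\<sigma>\<in>(\<Union>p\<in>I. G p). Fib \<sigma>)"
  proof (intro equalityI subsetI)
    fix \<tau> assume \<tau>: "\<tau> \<in> {\<tau> \<in> {\<tau> \<in> catalan_stanley. reduction \<tau> \<in> F}. ?a \<tau> = m \<and> ?b \<tau> = n}"
    then have *: "reduction \<tau> \<in> F" "\<tau> \<in> Fib (reduction \<tau>)" by (auto simp: Fib_def)
    show "\<tau> \<in> (\<Union>\<sigma>\<in>(\<Union>p\<in>I. G p). Fib \<sigma>)"
      using UG(2)[OF *(1) I[OF *]] *(2) by (rule UN_I)
  next
    fix \<tau> assume "\<tau> \<in> (\<Union>\<sigma>\<in>(\<Union>p\<in>I. G p). Fib \<sigma>)"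
    then obtain \<sigma> where "\<sigma> \<in> F" "\<tau> \<in> Fib \<sigma>" using UG(1) by blast
    then show "\<tau> \<in> {\<tau> \<in> {\<tau> \<in> catalan_stanley. reduction \<tau> \<in> F}. ?a \<tau> = m \<and> ?b \<tau> = n}"
      by (auto simp: Fib_def)
  qed
  then have "bivariate_gf {\<tau> \<in> catalan_stanley. reduction \<tau> \<in> F} $ n $ m =
      of_nat (card (\<Union>\<sigma>\<in>(\<Union>p\<in>I. G p). Fib \<sigma>))"
    by (simp add: bivariate_gf_def)
  also have "card (\<Union>\<sigma>\<in>(\<Union>p\<in>I. G p). Fib \<sigma>) = (\<Sum>\<sigma>\<in>(\<Union>p\<in>I. G p). card (Fib \<sigma>))"
  proof (rule card_UN_disjoint)
    show "finite (\<Union>p\<in>I. G p)" using finG by (simp add: I_def)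
    show "\<forall>\<sigma>\<in>(\<Union>p\<in>I. G p). finite (Fib \<sigma>)" using Fib(1) UG(1) by blast
  qed (auto simp: Fib_def)
  also have "\<dots> = (\<Sum>p\<in>I. \<Sum>\<sigma>\<in>G p. card (Fib \<sigma>))"
    using finG by (intro sum.UNION_disjoint) (auto simp: I_def G_def)
  also have "real \<dots> = (\<Sum>p\<in>I. \<Sum>\<sigma>\<in>G p. c p)"
    unfolding of_nat_sum
  proof (intro sum.cong refl)
    fix p \<sigma> assume "p \<in> I" "\<sigma> \<in> G p"
    then show "real (card (Fib \<sigma>)) = c p"
      using Fib(2)[of \<sigma>] by (auto simp: G_def I_def c_def fps_X_power_mult_right_nth)
  qed
  also have "\<dots> = (\<Sum>k\<le>n. \<Sum>i\<le>m. real (card (G (k, i))) * c (k, i))"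
    by (simp add: I_def sum.cartesian_product)
  \<comment> \<open>The sum over \<open>i\<close> is a Cauchy product:
    \<open>card (G (k, i))\<close> is coefficient \<open>i\<close> of
    \<open>bivariate_gf F $ k\<close>.\<close>
  also have "\<dots> = (\<Sum>k\<le>n. (of_nat (n choose k) * (bivariate_gf F $ k * ?T ^ (2 * k))) $ m)"
    by (simp only: fps_of_nat[symmetric] fps_mult_left_const_nth, simp only: fps_mult_nth)
       (simp add: bivariate_gf_def c_def G_def sum_distrib_left atMost_atLeast0 mult_ac)
  also have "\<dots> = Phi (bivariate_gf F) $ n $ m"
    by (simp add: Phi_nth fps_sum_nth mult.assoc)
  finally show "bivariate_gf {\<tau> \<in> catalan_stanley. reduction \<tau> \<in> F} $ n $ m = Phi (bivariate_gf F) $ n $ m" .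
qed

lemma bivariate_gf_preimage_power:
  assumes "F \<subseteq> catalan_stanley"
  shows "bivariate_gf {\<tau> \<in> catalan_stanley. (reduction ^^ r) \<tau> \<in> F} = (Phi ^^ r) (bivariate_gf F)"
proof (induction r)
  case 0
  have "{\<tau> \<in> catalan_stanley. \<tau> \<in> F} = F" using assms by blast
  then show ?case by simp
next
  case (Suc r)
  let ?P = "{\<tau> \<in> catalan_stanley. (reduction ^^ r) \<tau> \<in> F}"
  \<comment> \<open>The first reduction is split off; the class is closed under it, so the reduced
    tree meets the membership condition in \<open>?P\<close>.\<close>
  have "{\<tau> \<in> catalan_stanley. (reduction ^^ Suc r) \<tau> \<in> F} = {\<tau> \<in> catalan_stanley. reduction \<tau> \<in> ?P}"
    using reduction_catalan_stanley by (auto simp: funpow_Suc_right simp del: funpow.simps)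
  then show ?case
    using bivariate_gf_preimage[of ?P] Suc by auto
qed

theorem mainTheorem4:
  fixes r :: nat and F :: "plane_tree set" and f :: "real fps fps" and T :: "real fps"
  assumes "F \<subseteq> catalan_stanley"
    and "f = bivariate_gf F"
    and "T = plane_tree_gf"
  shows "T = (1 - fps_radical root 2 (1 - 4 * fps_X)) / 2
    \<and> bivariate_gf {\<tau> \<in> catalan_stanley. (reduction ^^ r) \<tau> \<in> F} = (Phi ^^ r) f
    \<and> (Phi ^^ r) f =
        1 / (1 - fps_X * fps_const ((1 - T ^ (2 * r)) / (1 - T ^ 2)))
        * (f oo (fps_X * fps_const (T ^ (2 * r))
                 / (1 - fps_X * fps_const ((1 - T ^ (2 * r)) / (1 - T ^ 2)))))"
proof (intro conjI)
  show "T = (1 - fps_radical root 2 (1 - 4 * fps_X)) / 2"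
    unfolding assms(3) by (rule plane_tree_gf_radical)
  show "bivariate_gf {\<tau> \<in> catalan_stanley. (reduction ^^ r) \<tau> \<in> F} = (Phi ^^ r) f"
    using bivariate_gf_preimage_power assms by simp
  have "1 - T ^ (2 * r) = (\<Sum>i<r. T ^ (2 * i)) * (1 - T ^ 2)"
    using one_diff_power_eq[of "T ^ 2" r] by (simp add: mult.commute flip: power_mult)
  \<comment> \<open>\<open>T\<close> has no constant term, so \<open>1 - T^2\<close> has constant
    coefficient 1 and can be cancelled in the geometric sum formula.\<close>
  moreover have nz: "1 - T ^ 2 \<noteq> 0"
  proof
    assume "1 - T ^ 2 = 0"
    then have "(1 - T ^ 2) $ 0 = 0" by simp
    then show False by (simp add: assms(3) power2_eq_square plane_tree_gf_nth_0)
  qed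
  ultimately have geo: "(1 - T ^ (2 * r)) / (1 - T ^ 2) = (\<Sum>i<r. T ^ (2 * i))"
    by (simp only: nonzero_mult_div_cancel_right[OF nz])
  show "(Phi ^^ r) f =
        1 / (1 - fps_X * fps_const ((1 - T ^ (2 * r)) / (1 - T ^ 2)))
        * (f oo (fps_X * fps_const (T ^ (2 * r))
                 / (1 - fps_X * fps_const ((1 - T ^ (2 * r)) / (1 - T ^ 2)))))"
    unfolding geo
    by (simp add: Phi_power closed_form_def Let_def assms(3) fps_inverse_of_const_coeff_1)
qed

end
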